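(* Suppose $G$ is a group of order $n$. If there is an $(s,t)$-$\lambda$-fold near-factorization of $G$, then $s+t\le n$ and $$\lambda\le\frac{st}{s+t-1}.$$
   Context: For subsets $S,T$ of a finite group $G$ with identity $e$, and a positive integer $\lambda$, $(S,T)$ is a $\lambda$-fold near-factorization of $G$ if every non-identity element $g\in G$ can be written as $g=xy$ with $x\in S$, $y\in T$ in exactly $\lambda$ ways, and $xy\neq e$ for all $x\in S$, $y\in T$. It is an $(s,t)$-$\lambda$-fold near-factorization if moreover $|S|=s$ and $|T|=t$.
   Formalization: The bound on λ is stated only for n > 1: in the trivial group, empty S and T form an (s,t)-λ-fold near-factorization for every λ, and st/(s+t-1) is then 0 (or 0/0 if one of S, T is {e}), so the bound fails or is undefined; s+t ≤ n is stated for all n. *)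

theory Defs
  imports Complex_Main "HOL-Algebra.Coset"
begin

(* Ways of writing g are counted as ordered pairs (x, y) in S \<times> T. For a finite group G all
   cardinalities below are those of finite sets. *)
definition near_factorization ::
    "('a, 'b) monoid_scheme \<Rightarrow> nat \<Rightarrow> 'a set \<Rightarrow> 'a set \<Rightarrow> bool" where
  "near_factorization G lam S T \<longleftrightarrow>
     0 < lam \<and> S \<subseteq> carrier G \<and> T \<subseteq> carrier G \<and>
     (\<forall>g \<in> carrier G - {\<one>\<^bsub>G\<^esub>}. card {(x, y). x \<in> S \<and> y \<in> T \<and> x \<otimes>\<^bsub>G\<^esub> y = g} = lam) \<and>
     (\<forall>x \<in> S. \<forall>y \<in> T. x \<otimes>\<^bsub>G\<^esub> y \<noteq> \<one>\<^bsub>G\<^esub>)"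

definition sized_near_factorization ::
    "('a, 'b) monoid_scheme \<Rightarrow> nat \<Rightarrow> nat \<Rightarrow> nat \<Rightarrow> 'a set \<Rightarrow> 'a set \<Rightarrow> bool" where
  "sized_near_factorization G s t lam S T \<longleftrightarrow>
     near_factorization G lam S T \<and> card S = s \<and> card T = t"

(* In the trivial group (n = 1) the multiplicity condition is vacuous, so ({}, {}), ({\<one>}, {})
   and ({}, {\<one>}) are (s,t)-lam-fold near-factorizations for every lam > 0, while s t = 0 and
   s + t - 1 is 0 or -1. No bound on lam is possible there; a statement bounding lam by
   s t / (s + t - 1) therefore needs n > 1. *)

end

theory Submission
  imports Defs
begin

text \<open>Since no product \<open>x y\<close> is the identity, \<open>T\<close> avoids the inverses of \<open>S\<close>, which gives
  \<open>s + t \<le> n\<close>. Counting \<open>S \<times> T\<close> by products gives \<open>s t = \<lambda> (n - 1)\<close>, and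
  \<open>n - 1 \<ge> s + t - 1\<close>.\<close>

lemma (in group) near_factorization_card_add_le:
  assumes "finite (carrier G)" and "near_factorization G lam S T"
  shows "card S + card T \<le> order G"
proof -
  have S: "S \<subseteq> carrier G" and T: "T \<subseteq> carrier G"
    and ne: "\<And>x y. x \<in> S \<Longrightarrow> y \<in> T \<Longrightarrow> x \<otimes> y \<noteq> \<one>"
    using assms(2) by (auto simp: near_factorization_def)
  have fin: "finite S" "finite T"
    using S T assms(1) finite_subset by blast+
  have "inj_on (\<lambda>x. inv x) S"
    using S inv_inj inj_on_subset by blast
  then have "card S + card T = card ((\<lambda>x. inv x) ` S) + card T"
    by (simp add: card_image)
  also have "\<dots> = card ((\<lambda>x. inv x) ` S \<union> T)"
  proof (rule card_Un_disjoint [symmetric])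
    \<comment> \<open>A common element would be \<open>inv x\<close> with \<open>x\<close> in
      \<open>S\<close>, and \<open>x \<otimes> inv x = \<one>\<close> contradicts
      \<open>ne\<close>.\<close>
    show "(\<lambda>x. inv x) ` S \<inter> T = {}"
      using ne S by fastforce
  qed (use fin in auto)
  also have "\<dots> \<le> order G"
    unfolding order_def using S T by (intro card_mono assms(1)) auto
  finally show ?thesis .
qed

text \<open>Double counting: the product map sends \<open>S \<times> T\<close> into the non-identity
  elements, and each of its \<open>order G - 1\<close> fibres has size \<open>lam\<close>. In the
  trivial group both sides are 0.\<close>

lemma (in group) near_factorization_card_mult:
  assumes "finite (carrier G)" and "near_factorization G lam S T"
  shows "card S * card T = lam * (order G - 1)"
proof -
  have S: "S \<subseteq> carrier G" and T: "T \<subseteq> carrier G"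
    and ne: "\<And>x y. x \<in> S \<Longrightarrow> y \<in> T \<Longrightarrow> x \<otimes> y \<noteq> \<one>"
    and cnt: "\<And>g. g \<in> carrier G - {\<one>} \<Longrightarrow>
      card {(x, y). x \<in> S \<and> y \<in> T \<and> x \<otimes> y = g} = lam"
    using assms(2) by (auto simp: near_factorization_def)
  have fin: "finite (S \<times> T)"
    using S T assms(1) finite_subset by blast
  have "card S * card T = (\<Sum>p\<in>S \<times> T. 1)"
    by (simp add: card_cartesian_product)
  \<comment> \<open>Partition of the pairs into fibres of the product map; \<open>ne\<close> is what
    allows the identity to be left out of the index set.\<close>
  also have "\<dots> = (\<Sum>g\<in>carrier G - {\<one>}. \<Sum>p\<in>{p \<in> S \<times> T. fst p \<otimes> snd p = g}. 1)"
    using S T ne by (intro sum.group [symmetric] fin) (auto simp: assms(1) subset_iff)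
  also have "\<dots> = (\<Sum>g\<in>carrier G - {\<one>}. lam)"
  proof (rule sum.cong [OF refl])
    fix g assume "g \<in> carrier G - {\<one>}"
    moreover have "{p \<in> S \<times> T. fst p \<otimes> snd p = g}
        = {(x, y). x \<in> S \<and> y \<in> T \<and> x \<otimes> y = g}"
      by auto
    ultimately show "(\<Sum>p\<in>{p \<in> S \<times> T. fst p \<otimes> snd p = g}. 1) = lam"
      using cnt by simp
  qed
  also have "\<dots> = lam * (order G - 1)"
    by (simp add: order_def assms(1) mult.commute)
  finally show ?thesis .
qed

theorem theorem1p16:
  fixes G :: "('a, 'b) monoid_scheme" and n s t lam :: nat
  assumes "group G" and "finite (carrier G)" and "order G = n"
    and "\<exists>S T. sized_near_factorization G s t lam S T"
  shows "s + t \<le> n \<and>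
    (n > 1 \<longrightarrow> real lam \<le> (real s * real t) / (real s + real t - 1))"
proof (intro conjI impI)
  obtain S T where nf: "near_factorization G lam S T" and st: "card S = s" "card T = t"
    using assms(4) by (auto simp: sized_near_factorization_def)
  show le: "s + t \<le> n"
    using group.near_factorization_card_add_le [OF assms(1,2) nf] st assms(3) by simp
  assume n: "n > 1"
  have mult: "s * t = lam * (n - 1)"
    using group.near_factorization_card_mult [OF assms(1,2) nf] st assms(3) by simp
  \<comment> \<open>With \<open>n > 1\<close> this makes \<open>s * t\<close> nonzero, so neither
    factor is empty and \<open>s + t - 1\<close> is at least 1.\<close>
  moreover have "lam > 0"
    using nf by (simp add: near_factorization_def)
  ultimately have "s * t > 0"
    using n by simp
  then have pos: "s > 0" "t > 0"
    by auto
  have "lam * (s + t - 1) \<le> s * t"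
    unfolding mult using le by (intro mult_le_mono2 diff_le_mono)
  then have "real (lam * (s + t - 1)) \<le> real (s * t)"
    by (rule of_nat_mono)
  \<comment> \<open>By \<open>pos\<close> the truncated subtraction in \<open>s + t - 1\<close>
    agrees with the real one, and the denominator is positive, so dividing keeps the
    inequality.\<close>
  then show "real lam \<le> (real s * real t) / (real s + real t - 1)"
    using pos by (simp add: le_divide_eq of_nat_diff)
qed

end
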